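(* Let \(X\subseteq\operatorname{Homeo}_+(I)\) be a (possibly infinite) geometrically fast set, with the bumps used in \(X\) equipped with a marking witnessing geometric fastness, and let \(E\) be a set of bumps which is extraneous in \(X\) (as witnessed by some interval \(J\)). Then the map \(g\mapsto g/E\) (\(g\in X\)) extends to an isomorphism between \(\langle X\rangle\) and \(\langle X/E\rangle\).
   Context: \(I=[0,1]\); homeomorphisms act on the right. Support \(\operatorname{supt}(f)=\{t:tf\neq t\}\). A left (right) transition point of \(f\) is \(t\notin\operatorname{supt}(f)\) such that \((t,t+\epsilon)\) (resp. \((t-\epsilon,t)\)) meets \(\operatorname{supt}(f)\) for every \(\epsilon>0\). A bump is an element with one orbital (connected component of support), positive if \(ta>t\) on its support. A positive bump \(a\) is used in \(f\) if \(f\) agrees with \(a\) or \(a^{-1}\) on \(\operatorname{supt}(a)\); used in \(X\) if used in some \(f\in X\). \(X\) is geometrically proper if no point is a left transition point of two distinct elements of \(X\), nor a right transition point of two distinct elements. A marking of the set \(A\) of bumps used in \(X\) assigns each \(a\) a marker \(t\in\operatorname{supt}(a)\); the feet of \(a\) (support \((x,y)\)) are \((x,t)\) and \([ta,y)\); the feet of \(g\in X\) are the feet of the bumps used in \(g\). \(X\) is geometrically fast if it is geometrically proper and the marking makes all feet of \(A\) pairwise disjoint. A bump in \(A\) is isolated if its support contains no transition point of any element of \(A\). For \(f\in\operatorname{Homeo}_+(I)\) and a set \(E\) of positive bumps, \(f/E\) agrees with \(f\) on \(I\setminus\bigcup\{\operatorname{supt}(a): a\in E \text{ used in } f\}\)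 and is the identity elsewhere; \(X/E=\{f/E: f\in X\}\). \(E\) is extraneous in \(X\) as witnessed by an interval \(J\subseteq I\) if for some \(f\in X\): every element of \(E\) is an isolated bump used in \(f\) with support contained in \(J\); some bump used in \(f\) and not in \(E\) has a foot contained in \(J\); and \(J\) is disjoint from the feet of all \(g\in X\setminus\{f\}\). *)

theory Defs
  imports "HOL-Analysis.Analysis" "HOL-Algebra.Generated_Groups"
begin

type_synonym hom = "real \<Rightarrow> real"

text \<open>Homeo_+(I), I = [0,1]. Elements are represented as functions real => real that
  are the identity outside I, so that equality of homeomorphisms is equality of functions.
  Homeomorphisms act on the right: t f = f t, hence the product f g is g o f.\<close>
definition Homeo_plus :: "hom set" where
  "Homeo_plus = {f. (\<exists>g. homeomorphism {0..1} {0..1} f g) \<and> mono_on {0..1} f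
                    \<and> (\<forall>t. t \<notin> {0..1} \<longrightarrow> f t = t)}"

definition homeo_group :: "hom monoid" where
  "homeo_group = \<lparr>carrier = Homeo_plus, mult = (\<lambda>f g. g \<circ> f), one = id\<rparr>"

definition gen_group :: "hom set \<Rightarrow> hom monoid" where
  "gen_group X = homeo_group\<lparr>carrier := generate homeo_group X\<rparr>"

definition supt :: "hom \<Rightarrow> real set" where
  "supt f = {t. f t \<noteq> t}"

definition left_transition_point :: "hom \<Rightarrow> real \<Rightarrow> bool" where
  "left_transition_point f t \<longleftrightarrow> t \<in> {0..1} \<and> t \<notin> supt f \<and>
     (\<forall>\<epsilon>>0. {t<..<t+\<epsilon>} \<inter> supt f \<noteq> {})"

definition right_transition_point :: "hom \<Rightarrow> real \<Rightarrow> bool" where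
  "right_transition_point f t \<longleftrightarrow> t \<in> {0..1} \<and> t \<notin> supt f \<and>
     (\<forall>\<epsilon>>0. {t-\<epsilon><..<t} \<inter> supt f \<noteq> {})"

definition transition_point :: "hom \<Rightarrow> real \<Rightarrow> bool" where
  "transition_point f t \<longleftrightarrow> left_transition_point f t \<or> right_transition_point f t"

definition bump :: "hom \<Rightarrow> bool" where
  "bump a \<longleftrightarrow> a \<in> Homeo_plus \<and> (\<exists>x y. x < y \<and> supt a = {x<..<y})"

definition positive_bump :: "hom \<Rightarrow> bool" where
  "positive_bump a \<longleftrightarrow> bump a \<and> (\<forall>t\<in>supt a. a t > t)"

definition used_in :: "hom \<Rightarrow> hom \<Rightarrow> bool" where
  "used_in a f \<longleftrightarrow> positive_bump a \<and>
     ((\<forall>t\<in>supt a. f t = a t) \<or> (\<forall>t\<in>supt a. f t = inv_into UNIV a t))"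

definition used_bumps :: "hom set \<Rightarrow> hom set" where
  "used_bumps X = {a. \<exists>f\<in>X. used_in a f}"

definition geometrically_proper :: "hom set \<Rightarrow> bool" where
  "geometrically_proper X \<longleftrightarrow>
     (\<forall>t. \<forall>f\<in>X. \<forall>g\<in>X. f \<noteq> g \<longrightarrow>
        \<not> (left_transition_point f t \<and> left_transition_point g t) \<and>
        \<not> (right_transition_point f t \<and> right_transition_point g t))"

definition left_foot :: "(hom \<Rightarrow> real) \<Rightarrow> hom \<Rightarrow> real set" where
  "left_foot m a = {Inf (supt a)<..<m a}"

definition right_foot :: "(hom \<Rightarrow> real) \<Rightarrow> hom \<Rightarrow> real set" where
  "right_foot m a = {a (m a)..<Sup (supt a)}"

definition foot :: "(hom \<Rightarrow> real) \<Rightarrow> hom \<Rightarrow> bool \<Rightarrow> real set" where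
  "foot m a side = (if side then left_foot m a else right_foot m a)"

definition feet_of :: "(hom \<Rightarrow> real) \<Rightarrow> hom \<Rightarrow> real set set" where
  "feet_of m g = {foot m a s | a s. used_in a g}"

definition is_marking :: "hom set \<Rightarrow> (hom \<Rightarrow> real) \<Rightarrow> bool" where
  "is_marking X m \<longleftrightarrow> (\<forall>a\<in>used_bumps X. m a \<in> supt a)"

definition geometrically_fast_with :: "hom set \<Rightarrow> (hom \<Rightarrow> real) \<Rightarrow> bool" where
  "geometrically_fast_with X m \<longleftrightarrow> geometrically_proper X \<and> is_marking X m \<and>
     (\<forall>a\<in>used_bumps X. \<forall>b\<in>used_bumps X. \<forall>s s'. (a, s) \<noteq> (b, s') \<longrightarrow>
        foot m a s \<inter> foot m b s' = {})"

definition isolated_bump_in :: "hom set \<Rightarrow> hom \<Rightarrow> bool" where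
  "isolated_bump_in BS a \<longleftrightarrow> a \<in> BS \<and> (\<forall>b\<in>BS. \<forall>t\<in>supt a. \<not> transition_point b t)"

definition quot :: "hom \<Rightarrow> hom set \<Rightarrow> hom" where
  "quot f E = (\<lambda>t. if t \<in> \<Union>{supt a | a. a \<in> E \<and> used_in a f} then t else f t)"

definition quot_set :: "hom set \<Rightarrow> hom set \<Rightarrow> hom set" where
  "quot_set X E = (\<lambda>f. quot f E) ` X"

definition extraneous_witnessed :: "hom set \<Rightarrow> (hom \<Rightarrow> real) \<Rightarrow> hom set \<Rightarrow> real set \<Rightarrow> bool" where
  "extraneous_witnessed X m E J \<longleftrightarrow> is_interval J \<and> J \<subseteq> {0..1} \<and>
     (\<exists>f\<in>X.
        (\<forall>a\<in>E. isolated_bump_in (used_bumps X) a \<and> used_in a f \<and> supt a \<subseteq> J) \<and>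
        (\<exists>b s. used_in b f \<and> b \<notin> E \<and> foot m b s \<subseteq> J) \<and>
        (\<forall>g\<in>X - {f}. \<forall>F\<in>feet_of m g. F \<inter> J = {}))"

end

theory Submission
  imports Defs
begin

text \<open>
  Let \<open>f\<close> be the element in which the bumps of \<open>E\<close> are used and let \<open>U\<close> be the union of their
  supports. It has to be shown that a word acts trivially through \<open>X\<close> iff it acts trivially through
  \<open>X/E\<close>. The two actions agree as long as the orbit avoids \<open>U\<close>, so after conjugation one may start
  at a point of \<open>U \<subseteq> J\<close>. An interval that avoids the feet of \<open>g\<close> is either fixed pointwise
  by \<open>g\<close> or contained in a single fundamental domain of a bump of \<open>g\<close>, hence is thrown into a foot of
  that bump. Therefore \<open>J\<close> is moved as a block: after local cancellation the word either carries
  \<open>J\<close> into a foot disjoint from \<open>U\<close>, and is nontrivial in both groups, or it acts as \<open>f\<^sup>k\<close> in \<open>J\<close>. In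
  the latter case it is trivial on \<open>U\<close> in the action of \<open>X/E\<close>, while \<open>k\<close> can be read off near the end
  of the bump \<open>b \<notin> E\<close> of \<open>f\<close> that has a foot in \<open>J\<close>.
\<close>

abbreviation hinv :: "hom \<Rightarrow> hom" where
  "hinv \<equiv> inv_into UNIV"

section \<open>Homeomorphisms of the interval\<close>

text \<open>An increasing surjection of the line is continuous, and so is its inverse, hence the
  topological condition reduces to order. Maps built later only need monotonicity, surjectivity and
  the values outside the unit interval.\<close>

lemma Homeo_plus_iff:
  "f \<in> Homeo_plus \<longleftrightarrow> strict_mono f \<and> surj f \<and> (\<forall>t. t \<notin> {0..1} \<longrightarrow> f t = t)"
proof
  assume f: "f \<in> Homeo_plus"
  then obtain g where g: "homeomorphism {0..1} {0..1} f g" and m: "mono_on {0..1} f"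
    and o: "\<And>t. t \<notin> {0..1} \<Longrightarrow> f t = t"
    by (auto simp: Homeo_plus_def)
  have im: "f ` {0..1} = {0..1}" and inj: "inj_on f {0..1}"
    using g by (auto simp: homeomorphism_def intro: inj_on_inverseI)
  have "f s < f t" if "s < t" for s t
  proof (cases "s \<in> {0..1}")
    case s: True
    hence fs: "f s \<in> {0..1}" using im by blast
    show ?thesis
    proof (cases "t \<in> {0..1}")
      case True
      have "f s \<le> f t" using m s True that by (auto simp: mono_on_def)
      moreover have "f s \<noteq> f t" using inj s True that by (auto dest: inj_onD)
      ultimately show ?thesis by simp
    next
      case False
      thus ?thesis using o[of t] fs s that by auto
    qed
  next
    case s: False
    show ?thesis
    proof (cases "t \<in> {0..1}")
      case True
      hence "f t \<in> {0..1}" using im by blast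
      thus ?thesis using o[of s] s True that by auto
    next
      case False
      thus ?thesis using o[of s] o[of t] s that by auto
    qed
  qed
  moreover have "y \<in> range f" for y
    using im o[of y] by (cases "y \<in> {0..1}") (blast, metis rangeI)
  ultimately show "strict_mono f \<and> surj f \<and> (\<forall>t. t \<notin> {0..1} \<longrightarrow> f t = t)"
    using o by (auto simp: strict_mono_def)
next
  assume "strict_mono f \<and> surj f \<and> (\<forall>t. t \<notin> {0..1} \<longrightarrow> f t = t)"
  hence sm: "strict_mono f" and su: "surj f" and o: "\<And>t. t \<notin> {0..1} \<Longrightarrow> f t = t" by auto
  have inj: "inj f" using sm by (rule strict_mono_imp_inj_on)
  have fi: "f (hinv f t) = t" "hinv f (f t) = t" for t
    using su inj by (simp_all add: surj_f_inv_f)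
  have smi: "strict_mono (hinv f)"
    using sm fi by (metis strict_mono_def strict_mono_less)
  have suri: "surj (hinv f)" using inj by (rule inj_imp_surj_inv)
  have c: "continuous_on UNIV f" "continuous_on UNIV (hinv f)"
    using sm su smi suri by (auto intro!: continuous_onI_mono simp: strict_mono_less_eq)
  \<comment> \<open>If \<open>f t\<close> lay outside the interval for some \<open>t\<close> inside,
    then \<open>f (f t) = f t\<close>, and injectivity would give \<open>f t = t\<close>.\<close>
  have in01: "f t \<in> {0..1} \<longleftrightarrow> t \<in> {0..1}" for t
    by (metis inj injD o)
  have in01i: "hinv f t \<in> {0..1} \<longleftrightarrow> t \<in> {0..1}" for t
    using in01[of "hinv f t"] unfolding fi by simp
  have "homeomorphism {0..1} {0..1} f (hinv f)"
  proof (rule homeomorphismI)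
    show "f ` {0..1} \<subseteq> {0..1}" "hinv f ` {0..1} \<subseteq> {0..1}"
      using in01 in01i by blast+
  qed (use c fi in \<open>auto intro: continuous_on_subset\<close>)
  thus "f \<in> Homeo_plus"
    using sm o by (auto simp: Homeo_plus_def mono_on_def strict_mono_less_eq)
qed

lemma Homeo_plus_strict_mono: "f \<in> Homeo_plus \<Longrightarrow> strict_mono f"
  and Homeo_plus_less_iff: "f \<in> Homeo_plus \<Longrightarrow> f s < f t \<longleftrightarrow> s < t"
  and Homeo_plus_bij: "f \<in> Homeo_plus \<Longrightarrow> bij f"
  by (auto simp: Homeo_plus_iff strict_mono_less bij_def strict_mono_imp_inj_on)

lemma Homeo_plus_continuous: "f \<in> Homeo_plus \<Longrightarrow> continuous_on UNIV f"
  by (rule continuous_onI_mono) (auto simp: Homeo_plus_iff strict_mono_less_eq)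

lemma inv_apply_Homeo_plus:
  assumes "f \<in> Homeo_plus"
  shows "hinv f (f t) = t" and "f (hinv f t) = t"
  using Homeo_plus_bij[OF assms] by (auto simp: bij_def surj_f_inv_f)

lemma id_in_Homeo_plus: "id \<in> Homeo_plus"
  by (auto simp: Homeo_plus_iff strict_mono_def)

lemma comp_in_Homeo_plus: "f \<in> Homeo_plus \<Longrightarrow> g \<in> Homeo_plus \<Longrightarrow> g \<circ> f \<in> Homeo_plus"
  using comp_surj[of f g] by (simp add: Homeo_plus_iff strict_mono_def)

lemma inv_in_Homeo_plus:
  assumes "f \<in> Homeo_plus"
  shows "hinv f \<in> Homeo_plus"
proof -
  have "hinv f s < hinv f t" if "s < t" for s t
    using that Homeo_plus_less_iff[OF assms, of "hinv f s" "hinv f t"]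
    by (simp add: inv_apply_Homeo_plus[OF assms])
  moreover have "hinv f t = t" if "t \<notin> {0..1}" for t
    using that assms inv_apply_Homeo_plus(1)[OF assms, of t] by (auto simp: Homeo_plus_iff)
  ultimately show ?thesis
    using Homeo_plus_bij[OF assms]
    by (auto simp: Homeo_plus_iff strict_mono_def bij_def inj_imp_surj_inv)
qed

lemma homeo_group_simps [simp]:
  "carrier homeo_group = Homeo_plus"
  "f \<otimes>\<^bsub>homeo_group\<^esub> g = g \<circ> f"
  "\<one>\<^bsub>homeo_group\<^esub> = id"
  by (simp_all add: homeo_group_def)

lemma group_homeo_group: "group homeo_group"
proof (rule groupI)
  fix f assume "f \<in> carrier homeo_group"
  hence f: "f \<in> Homeo_plus" by simp
  show "\<exists>g\<in>carrier homeo_group. g \<otimes>\<^bsub>homeo_group\<^esub> f = \<one>\<^bsub>homeo_group\<^esub>"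
    using inv_in_Homeo_plus[OF f] inv_apply_Homeo_plus[OF f]
    by (intro bexI[of _ "hinv f"]) (auto simp: fun_eq_iff)
qed (auto simp: comp_in_Homeo_plus id_in_Homeo_plus comp_assoc)

lemma inv_homeo_group:
  assumes "f \<in> Homeo_plus"
  shows "inv\<^bsub>homeo_group\<^esub> f = hinv f"
  using inv_apply_Homeo_plus[OF assms] assms inv_in_Homeo_plus[OF assms]
  by (intro group.inv_equality[OF group_homeo_group]) (auto simp: fun_eq_iff)

section \<open>Bumps\<close>

lemma supt_inv: "f \<in> Homeo_plus \<Longrightarrow> supt (hinv f) = supt f"
  unfolding supt_def by (metis inv_apply_Homeo_plus)

text \<open>Fixing both ends, \<open>h\<close> preserves the open interval, so gluing with the
  identity stays increasing and onto. This cuts a single bump out of a homeomorphism.\<close>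

lemma Homeo_plus_restrict:
  assumes h: "h \<in> Homeo_plus" and "h x = x" "h y = y"
  shows "(\<lambda>s. if s \<in> {x<..<y} then h s else s) \<in> Homeo_plus" (is "?a \<in> _")
proof -
  have in_iff: "h s \<in> {x<..<y} \<longleftrightarrow> s \<in> {x<..<y}" for s
    using Homeo_plus_less_iff[OF h, of x s] Homeo_plus_less_iff[OF h, of s y] assms by auto
  have "?a s < ?a t" if "s < t" for s t
    using that in_iff[of s] in_iff[of t] Homeo_plus_less_iff[OF h, of s t] by auto
  moreover have "t \<in> range ?a" for t
  proof (cases "t \<in> {x<..<y}")
    case True
    hence "?a (hinv h t) = t"
      using in_iff[of "hinv h t"] by (auto simp: inv_apply_Homeo_plus[OF h])
    thus ?thesis by (rule range_eqI[OF sym])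
  next
    case False
    hence "?a t = t" by auto
    thus ?thesis by (rule range_eqI[OF sym])
  qed
  ultimately show ?thesis
    using h by (auto simp: Homeo_plus_iff strict_mono_def)
qed

lemma bump_inv_mem_supt:
  assumes "positive_bump a"
  shows "a t \<in> supt a \<longleftrightarrow> t \<in> supt a" "hinv a t \<in> supt a \<longleftrightarrow> t \<in> supt a"
  using assms inv_apply_Homeo_plus[of a] unfolding positive_bump_def bump_def supt_def
  by (auto, metis+)

lemma positive_bump_supt:
  assumes "positive_bump a"
  shows "supt a = {Inf (supt a)<..<Sup (supt a)}" "Inf (supt a) < Sup (supt a)"
proof -
  obtain x y where "x < y" "supt a = {x<..<y}"
    using assms unfolding positive_bump_def bump_def by blast
  thus "supt a = {Inf (supt a)<..<Sup (supt a)}" "Inf (supt a) < Sup (supt a)" by auto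
qed

text \<open>One flag covers both orientations: \<open>e\<close> holds when \<open>f\<close> runs
  through the bump backwards. The formula for the inverse follows because \<open>a\<close> and its
  inverse preserve the support.\<close>

lemma used_inE:
  assumes "used_in a f" "f \<in> Homeo_plus"
  obtains e where
    "\<And>t. t \<in> supt a \<Longrightarrow> f t = (if e then hinv a t else a t)"
    "\<And>t. t \<in> supt a \<Longrightarrow> hinv f t = (if e then a t else hinv a t)"
proof -
  have p: "positive_bump a" and a: "a \<in> Homeo_plus"
    using assms by (auto simp: used_in_def positive_bump_def bump_def)
  note i = inv_apply_Homeo_plus[OF a] inv_apply_Homeo_plus[OF assms(2)]
  have "(\<forall>t\<in>supt a. f t = a t) \<or> (\<forall>t\<in>supt a. f t = hinv a t)"
    using assms by (auto simp: used_in_def)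
  thus thesis
  proof
    assume "\<forall>t\<in>supt a. f t = a t"
    thus thesis by (intro that[of False]) (simp, metis i bump_inv_mem_supt[OF p])
  next
    assume "\<forall>t\<in>supt a. f t = hinv a t"
    thus thesis by (intro that[of True]) (simp, metis i bump_inv_mem_supt[OF p])
  qed
qed

lemma used_in_mem_supt_iff:
  assumes "used_in a f" "f \<in> Homeo_plus"
  shows "f t \<in> supt a \<longleftrightarrow> t \<in> supt a"
proof -
  have p: "positive_bump a" using assms by (auto simp: used_in_def)
  obtain e where e: "\<And>t. t \<in> supt a \<Longrightarrow> f t = (if e then hinv a t else a t)"
    "\<And>t. t \<in> supt a \<Longrightarrow> hinv f t = (if e then a t else hinv a t)"
    using used_inE[OF assms] by blast
  show ?thesis
    using e(1)[of t] e(2)[of "f t"] bump_inv_mem_supt[OF p, of t] bump_inv_mem_supt[OF p, of "f t"]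
    by (auto simp: inv_apply_Homeo_plus[OF assms(2)] split: if_splits)
qed

lemma used_in_supt_subset:
  assumes "used_in a f" "f \<in> Homeo_plus"
  shows "supt a \<subseteq> supt f"
proof
  fix t assume t: "t \<in> supt a"
  have a: "a \<in> Homeo_plus" using assms by (auto simp: used_in_def positive_bump_def bump_def)
  have "a t \<noteq> t" "hinv a t \<noteq> t" using t supt_inv[OF a] by (auto simp: supt_def)
  moreover have "f t = a t \<or> f t = hinv a t" using t assms by (auto simp: used_in_def)
  ultimately show "t \<in> supt f" by (auto simp: supt_def)
qed

text \<open>Preimages of points of the interval stay in it, which gives \<open>f x \<le> x\<close>
  and \<open>y \<le> f y\<close>. A strict inequality would push points near that end out of the
  interval.\<close>

lemma Homeo_plus_endpoints_fixed:
  assumes f: "f \<in> Homeo_plus" and "x < y" and iff: "\<And>t. f t \<in> {x<..<y} \<longleftrightarrow> t \<in> {x<..<y}"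
  shows "f x = x" "f y = y"
proof -
  have r: "z \<in> {x<..<y} \<Longrightarrow> hinv f z \<in> {x<..<y}" for z
    using iff[of "hinv f z"] by (simp add: inv_apply_Homeo_plus[OF f])
  have lt: "f s < f t \<longleftrightarrow> s < t" for s t by (rule Homeo_plus_less_iff[OF f])
  have low: "f x \<le> x"
  proof (rule dense_ge_bounded[OF \<open>x < y\<close>])
    fix z assume "x < z" "z < y"
    thus "f x \<le> z" using r[of z] lt[of x "hinv f z"] by (simp add: inv_apply_Homeo_plus[OF f])
  qed
  have high: "y \<le> f y"
  proof (rule dense_le_bounded[OF \<open>x < y\<close>])
    fix z assume "x < z" "z < y"
    thus "z \<le> f y" using r[of z] lt[of "hinv f z" y] by (simp add: inv_apply_Homeo_plus[OF f])
  qed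
  show "f x = x"
  proof (rule ccontr)
    assume "f x \<noteq> x"
    hence l: "f x < f (hinv f x)" using low by (simp add: inv_apply_Homeo_plus[OF f])
    hence "x < hinv f x" by (simp add: lt)
    then obtain z where z: "x < z" "z < hinv f x" "z < y"
      using dense[of x "min (hinv f x) y"] \<open>x < y\<close> by auto
    hence "f z < x" using lt[of z "hinv f x"] by (simp add: inv_apply_Homeo_plus[OF f])
    thus False using iff[of z] z by auto
  qed
  show "f y = y"
  proof (rule ccontr)
    assume "f y \<noteq> y"
    hence l: "f (hinv f y) < f y" using high by (simp add: inv_apply_Homeo_plus[OF f])
    hence "hinv f y < y" by (simp add: lt)
    then obtain z where z: "hinv f y < z" "z < y" "x < z"
      using dense[of "max (hinv f y) x" y] \<open>x < y\<close> by auto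
    hence "y < f z" using lt[of "hinv f y" z] by (simp add: inv_apply_Homeo_plus[OF f])
    thus False using iff[of z] z by auto
  qed
qed

lemma used_in_endpoints_fixed:
  assumes "used_in a f" "f \<in> Homeo_plus"
  shows "f (Inf (supt a)) = Inf (supt a)" "f (Sup (supt a)) = Sup (supt a)"
proof -
  have p: "positive_bump a" using assms by (auto simp: used_in_def)
  have "f t \<in> {Inf (supt a)<..<Sup (supt a)} \<longleftrightarrow> t \<in> {Inf (supt a)<..<Sup (supt a)}" for t
    using used_in_mem_supt_iff[OF assms, of t] positive_bump_supt(1)[OF p] by simp
  from Homeo_plus_endpoints_fixed[OF assms(2) positive_bump_supt(2)[OF p] this]
  show "f (Inf (supt a)) = Inf (supt a)" "f (Sup (supt a)) = Sup (supt a)" by auto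
qed

text \<open>\<open>f\<close> fixes the ends of both supports and moves all their points, so no end
  of one lies in the other; overlapping open intervals of this kind coincide.\<close>

lemma used_in_supt_eq:
  assumes f: "f \<in> Homeo_plus" and a: "used_in a f" and b: "used_in b f"
    and "supt a \<inter> supt b \<noteq> {}"
  shows "supt a = supt b"
proof -
  have p: "positive_bump a" "positive_bump b" using a b by (auto simp: used_in_def)
  note s = positive_bump_supt(1)[OF p(1)] positive_bump_supt(1)[OF p(2)]
  have nf: "f z = z \<Longrightarrow> z \<notin> supt a \<and> z \<notin> supt b" for z
    using used_in_supt_subset[OF a f] used_in_supt_subset[OF b f] by (auto simp: supt_def)
  obtain t where t: "t \<in> supt a" "t \<in> supt b" using assms by blast
  define xa ya xb yb where "xa = Inf (supt a)" "ya = Sup (supt a)" "xb = Inf (supt b)" "yb = Sup (supt b)"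
  have e: "supt a = {xa<..<ya}" "supt b = {xb<..<yb}"
    using s unfolding xa_ya_xb_yb_def by simp_all
  have "xa \<notin> supt b" "ya \<notin> supt b" "xb \<notin> supt a" "yb \<notin> supt a"
    using nf used_in_endpoints_fixed[OF a f] used_in_endpoints_fixed[OF b f]
    unfolding xa_ya_xb_yb_def by blast+
  thus ?thesis using t unfolding e by auto
qed

text \<open>The orbital of \<open>t\<close> ends at the nearest fixed points on both sides. By
  connectedness \<open>g s - s\<close> keeps its sign between them, so \<open>g\<close> or its
  inverse, cut down to this interval, is a positive bump.\<close>

lemma ex_used_bump:
  assumes g: "g \<in> Homeo_plus" and t: "t \<in> supt g"
  obtains a where "used_in a g" "t \<in> supt a"
proof -
  have cont: "continuous_on UNIV g" by (rule Homeo_plus_continuous[OF g])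
  have out: "g s = s" if "s \<notin> {0..1}" for s using g that by (auto simp: Homeo_plus_iff)
  have t01: "t \<in> {0..1}" using t out by (auto simp: supt_def)
  have cl: "closed {s. g s = s}"
    using cont by (intro closed_Collect_eq) auto
  define L where "L = {s. g s = s} \<inter> {..t}"
  define R where "R = {s. g s = s} \<inter> {t..}"
  define x where "x = Sup L"
  define y where "y = Inf R"
  \<comment> \<open>Points outside the unit interval are fixed, so \<open>-1\<close> and
    \<open>2\<close> keep both sets nonempty.\<close>
  have ne: "-1 \<in> L" "2 \<in> R" using t01 out[of "-1"] out[of 2] by (auto simp: L_def R_def)
  have bd: "bdd_above L" "bdd_below R" by (auto simp: L_def R_def intro: bdd_aboveI bdd_belowI)
  have xL: "x \<in> L" unfolding x_def
    using ne bd cl by (intro closed_contains_Sup) (auto simp: L_def intro: closed_Int)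
  have yR: "y \<in> R" unfolding y_def
    using ne bd cl by (intro closed_contains_Inf) (auto simp: R_def intro: closed_Int)
  have xy: "g x = x" "g y = y" "x < t" "t < y"
    using xL yR t by (auto simp: L_def R_def supt_def order.strict_iff_order)
  have mv: "g s \<noteq> s" if "s \<in> {x<..<y}" for s
  proof
    assume s: "g s = s"
    show False
    proof (cases "s \<le> t")
      case True
      hence "s \<le> x" unfolding x_def using s bd by (intro cSup_upper) (auto simp: L_def)
      thus False using that by simp
    next
      case False
      hence "y \<le> s" unfolding y_def using s bd by (intro cInf_lower) (auto simp: R_def)
      thus False using that by simp
    qed
  qed
  have sgn: "g s > s \<longleftrightarrow> g t > t" if "s \<in> {x<..<y}" for s
  proof -
    have conn: "connected ((\<lambda>s. g s - s) ` {x<..<y})"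
      by (intro connected_continuous_image continuous_intros continuous_on_subset[OF cont]) auto
    have z: "0 \<notin> (\<lambda>s. g s - s) ` {x<..<y}" using mv by force
    have ts: "t \<in> {x<..<y}" using xy by simp
    show ?thesis
    proof (rule ccontr)
      assume "\<not> ?thesis"
      hence "(g s - s < 0 \<and> 0 < g t - t) \<or> (g t - t < 0 \<and> 0 < g s - s)"
        using mv[OF that] mv[OF ts] by auto
      hence "0 \<in> (\<lambda>s. g s - s) ` {x<..<y}"
        using connectedD_interval[OF conn, of "g s - s" "g t - t" 0]
              connectedD_interval[OF conn, of "g t - t" "g s - s" 0] that ts by fastforce
      thus False using z by simp
    qed
  qed
  define h where "h = (if g t > t then g else hinv g)"
  have h: "h \<in> Homeo_plus" using g inv_in_Homeo_plus[OF g] by (simp add: h_def)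
  have ginv: "hinv g (g s) = s" "g (hinv g s) = s" for s using inv_apply_Homeo_plus[OF g] by auto
  have hxy: "h x = x" "h y = y" using xy ginv by (auto simp: h_def) (metis+)
  have pos: "h s > s" if s: "s \<in> {x<..<y}" for s
  proof (cases "g t > t")
    case True thus ?thesis using sgn[OF s] by (simp add: h_def)
  next
    case False
    hence "g s < s" using sgn[OF s] mv[OF s] by auto
    hence "g s < g (hinv g s)" by (simp add: ginv)
    thus ?thesis using False by (simp add: h_def Homeo_plus_less_iff[OF g])
  qed
  define a where "a = (\<lambda>s. if s \<in> {x<..<y} then h s else s)"
  have aH: "a \<in> Homeo_plus" unfolding a_def by (rule Homeo_plus_restrict[OF h hxy])
  have sa: "supt a = {x<..<y}" using pos by (force simp: a_def supt_def)
  have "bump a" unfolding bump_def using aH sa xy by (metis less_trans)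
  hence pb: "positive_bump a" using sa pos by (auto simp: positive_bump_def a_def)
  have "hinv a s = g s" if s: "s \<in> {x<..<y}" "\<not> g t > t" for s
  proof -
    have "h (g s) = s" using s ginv by (simp add: h_def)
    moreover have "g s \<in> {x<..<y}"
      using s Homeo_plus_less_iff[OF g, of x s] Homeo_plus_less_iff[OF g, of s y] xy by auto
    ultimately have "a (g s) = s" by (simp add: a_def)
    thus ?thesis using inv_apply_Homeo_plus(1)[OF aH, of "g s"] by simp
  qed
  hence "used_in a g"
    unfolding used_in_def using pb sa by (cases "g t > t") (auto simp: a_def h_def)
  moreover have "t \<in> supt a" using sa xy by simp
  ultimately show thesis by (rule that)
qed

section \<open>Feet\<close>

lemma used_in_Homeo_plus: "used_in a f \<Longrightarrow> a \<in> Homeo_plus"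
  by (simp add: used_in_def positive_bump_def bump_def)

lemma positive_bump_less:
  assumes "positive_bump a" "t \<in> supt a"
  shows "t < a t" "hinv a t < t"
proof -
  have a: "a \<in> Homeo_plus" using assms by (simp add: positive_bump_def bump_def)
  show "t < a t" using assms by (simp add: positive_bump_def)
  have "hinv a t \<in> supt a" using assms by (simp add: bump_inv_mem_supt)
  hence "hinv a t < a (hinv a t)" using assms(1) by (simp add: positive_bump_def)
  thus "hinv a t < t" by (simp add: inv_apply_Homeo_plus[OF a])
qed

text \<open>The support splits into the left foot, the fundamental domain
  \<open>{m a..<a (m a)}\<close> and the right foot. The bump sends the domain into the right foot
  and the right foot into itself; its inverse does the same on the left.\<close>

lemma foot_facts:
  assumes p: "positive_bump a" and ma: "m a \<in> supt a"
  shows foot_subset_supt: "foot m a s \<subseteq> supt a"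
    and foot_nonempty: "foot m a s \<noteq> {}"
    and foot_interval: "is_interval (foot m a s)"
    and foot_invariant: "t \<in> foot m a s \<Longrightarrow> (if s then hinv a t else a t) \<in> foot m a s"
    and middle_to_foot: "t \<in> {m a..<a (m a)} \<Longrightarrow> (if s then hinv a t else a t) \<in> foot m a s"
    and middle_subset_supt: "{m a..<a (m a)} \<subseteq> supt a"
proof -
  define x y where "x = Inf (supt a)" and "y = Sup (supt a)"
  have s: "supt a = {x<..<y}" using positive_bump_supt[OF p] by (simp add: x_def y_def)
  have a: "a \<in> Homeo_plus" using p by (simp add: positive_bump_def bump_def)
  have foot: "foot m a s = (if s then {x<..<m a} else {a (m a)..<y})" for s
    by (simp add: foot_def left_foot_def right_foot_def x_def y_def)
  have am: "a (m a) \<in> supt a" using ma by (simp add: bump_inv_mem_supt[OF p])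
  have lt: "m a < a (m a)" by (rule positive_bump_less[OF p ma])
  show sub: "foot m a s \<subseteq> supt a"
    using ma am lt unfolding foot s by (cases s) auto
  show "foot m a s \<noteq> {}" using ma am unfolding s foot by (cases s) auto
  show "is_interval (foot m a s)" by (auto simp: foot is_interval_1)
  show mid: "{m a..<a (m a)} \<subseteq> supt a" using ma am unfolding s by auto
  have mem: "a t \<in> {x<..<y}" "hinv a t \<in> {x<..<y}" if "t \<in> supt a" for t
    using that bump_inv_mem_supt[OF p, of t] by (simp_all add: s)
  show "(if s then hinv a t else a t) \<in> foot m a s" if t: "t \<in> foot m a s"
  proof -
    have "t \<in> supt a" using t sub by blast
    from mem[OF this] positive_bump_less[OF p this] t show ?thesis
      by (auto simp: foot split: if_splits)
  qed
  show "(if s then hinv a t else a t) \<in> foot m a s" if t: "t \<in> {m a..<a (m a)}"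
  proof -
    have "t \<in> supt a" using t mid by blast
    from mem[OF this] positive_bump_less[OF p this] t
      Homeo_plus_less_iff[OF a, of t "m a"] Homeo_plus_less_iff[OF a, of "hinv a t" "m a"]
    show ?thesis by (auto simp: foot inv_apply_Homeo_plus[OF a])
  qed
qed

text \<open>Once \<open>K\<close> meets the support of a bump \<open>d\<close>, it does so in the
  fundamental domain, and by convexity it cannot leave that domain without crossing a foot of
  \<open>d\<close>.\<close>

lemma interval_avoiding_feet:
  assumes g: "g \<in> Homeo_plus" and K: "is_interval K"
    and mark: "\<And>a. used_in a g \<Longrightarrow> m a \<in> supt a"
    and avoid: "\<And>a s. used_in a g \<Longrightarrow> foot m a s \<inter> K = {}"
  shows "K \<inter> supt g = {} \<or> (\<exists>d. used_in d g \<and> K \<subseteq> {m d..<d (m d)})"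
proof (rule disjCI)
  assume "\<not> (\<exists>d. used_in d g \<and> K \<subseteq> {m d..<d (m d)})"
  hence no: "\<not> K \<subseteq> {m d..<d (m d)}" if "used_in d g" for d using that by blast
  show "K \<inter> supt g = {}"
  proof (rule ccontr)
    assume "K \<inter> supt g \<noteq> {}"
    then obtain t where t: "t \<in> K" "t \<in> supt g" by blast
    then obtain d where d: "used_in d g" "t \<in> supt d" using ex_used_bump[OF g] by blast
    have p: "positive_bump d" using d by (simp add: used_in_def)
    define x y where "x = Inf (supt d)" and "y = Sup (supt d)"
    have s: "supt d = {x<..<y}" using positive_bump_supt[OF p] by (simp add: x_def y_def)
    have md: "m d \<in> supt d" using mark d by blast
    have dm: "d (m d) \<in> supt d" using md by (simp add: bump_inv_mem_supt[OF p])
    have L: "z \<notin> K" if "x < z" "z < m d" for z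
      using avoid[OF d(1), of True] that
      by (auto simp: foot_def left_foot_def x_def)
    have R: "z \<notin> K" if "d (m d) \<le> z" "z < y" for z
      using avoid[OF d(1), of False] that
      by (auto simp: foot_def right_foot_def y_def)
    have conv: "z \<in> K" if "u \<in> K" "v \<in> K" "u \<le> z" "z \<le> v" for u v z
      using K that by (meson is_interval_1)
    have tm: "m d \<le> t" "t < d (m d)" using L[of t] R[of t] t d(2) s by force+
    have "z \<in> {m d..<d (m d)}" if z: "z \<in> K" for z
    proof (rule ccontr)
      assume "\<not> ?thesis"
      then consider "z < m d" | "d (m d) \<le> z" by force
      thus False
      proof cases
        case 1
        \<comment> \<open>\<open>z\<close> may lie at or beyond the open end \<open>x\<close>,
          outside the foot; the midpoint of \<open>x\<close> and \<open>m d\<close> then supplies a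
          point of \<open>K\<close> inside the foot. On the right, \<open>d (m d)\<close> itself
          belongs to the foot.\<close>
        define z' where "z' = max z ((x + m d) / 2)"
        have "x < z'" "z' < m d" using 1 md s by (auto simp: z'_def field_simps less_max_iff_disj)
        moreover have "z' \<in> K" using conv[OF z t(1), of z'] \<open>z' < m d\<close> tm by (auto simp: z'_def)
        ultimately show False using L by blast
      next
        case 2
        hence "d (m d) \<in> K" using conv[OF t(1) z, of "d (m d)"] tm by auto
        thus False using R[of "d (m d)"] dm s by auto
      qed
    qed
    thus False using no[OF d(1)] by blast
  qed
qed

section \<open>Words\<close>

type_synonym letter = "hom \<times> bool"

text \<open>The substitution \<open>q\<close> allows one formal word over \<open>X\<close> to be
  evaluated in both groups: with the identity in the group of \<open>X\<close>, with
  \<open>quot\<close> in that of \<open>X/E\<close>.\<close>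

definition letter_map :: "(hom \<Rightarrow> hom) \<Rightarrow> letter \<Rightarrow> hom" where
  "letter_map q l = (if snd l then q (fst l) else hinv (q (fst l)))"

definition words :: "hom set \<Rightarrow> letter list set" where
  "words X = {w. fst ` set w \<subseteq> X}"

definition word_inv :: "letter list \<Rightarrow> letter list" where
  "word_inv w = rev (map (\<lambda>l. (fst l, \<not> snd l)) w)"

text \<open>\<open>fold\<close> applies the first letter first, as right actions do, so
  concatenation of words becomes the product of the group.\<close>

abbreviation word_map :: "(hom \<Rightarrow> hom) \<Rightarrow> letter list \<Rightarrow> hom" where
  "word_map q w \<equiv> fold (letter_map q) w"

lemma words_simps [simp]:
  "[] \<in> words X" "l # w \<in> words X \<longleftrightarrow> fst l \<in> X \<and> w \<in> words X"
  "v @ w \<in> words X \<longleftrightarrow> v \<in> words X \<and> w \<in> words X"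
  "word_inv w \<in> words X \<longleftrightarrow> w \<in> words X"
  by (auto simp: words_def word_inv_def image_image)

lemma letter_map_in_Homeo_plus: "q (fst l) \<in> Homeo_plus \<Longrightarrow> letter_map q l \<in> Homeo_plus"
  by (simp add: letter_map_def inv_in_Homeo_plus)

lemma letter_map_cancel:
  assumes "q g \<in> Homeo_plus"
  shows "letter_map q (g, \<not> e) (letter_map q (g, e) t) = t"
  using inv_apply_Homeo_plus[OF assms] by (simp add: letter_map_def)

lemma word_map_in_Homeo_plus:
  assumes "q ` X \<subseteq> Homeo_plus"
  shows "w \<in> words X \<Longrightarrow> word_map q w \<in> Homeo_plus"
proof (induction w)
  case Nil
  show ?case using id_in_Homeo_plus by (simp add: id_def)
next
  case (Cons l w)
  have "letter_map q l \<in> Homeo_plus"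
    using Cons.prems assms by (auto intro: letter_map_in_Homeo_plus)
  from comp_in_Homeo_plus[OF this, of "word_map q w"] Cons show ?case by (simp add: comp_def)
qed

lemma word_map_word_inv:
  assumes "q ` X \<subseteq> Homeo_plus" and "w \<in> words X"
  shows "word_map q (word_inv w) (word_map q w t) = t" "word_map q w (word_map q (word_inv w) t) = t"
proof -
  show "word_map q (word_inv w) (word_map q w t) = t" for t
    using assms(2)
  proof (induction w arbitrary: t)
    case (Cons l w)
    have "q (fst l) \<in> Homeo_plus" using Cons.prems assms(1) by auto
    hence "letter_map q (fst l, \<not> snd l) (letter_map q l t) = t"
      using letter_map_cancel[of q "fst l" "snd l" t] by simp
    moreover have "word_map q (word_inv w) (word_map q w (letter_map q l t)) = letter_map q l t"
      using Cons by simp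
    ultimately show ?case by (simp add: word_inv_def)
  qed (simp add: word_inv_def)
  \<comment> \<open>The first instance identifies the map of \<open>word_inv w\<close> with the
    inverse function, which yields the other composite.\<close>
  from this[of "hinv (word_map q w) t"] this[of "word_map q (word_inv w) t"]
  show "word_map q w (word_map q (word_inv w) t) = t"
    using inv_apply_Homeo_plus[OF word_map_in_Homeo_plus[OF assms]] by metis
qed

lemma generate_eq_word_maps:
  assumes "q ` X \<subseteq> Homeo_plus"
  shows "generate homeo_group (q ` X) = word_map q ` words X"
proof (intro equalityI subsetI)
  fix h assume "h \<in> generate homeo_group (q ` X)"
  thus "h \<in> word_map q ` words X"
  proof induction
    case one
    have "word_map q [] = id" by simp
    thus ?case by (metis homeo_group_simps(3) imageI words_simps(1))
  next
    case (incl h)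
    then obtain g where "g \<in> X" "h = q g" by blast
    hence "[(g, True)] \<in> words X" "h = word_map q [(g, True)]" by (auto simp: letter_map_def)
    thus ?case by blast
  next
    case (inv h)
    then obtain g where g: "g \<in> X" "h = q g" by blast
    hence "h \<in> Homeo_plus" using assms by blast
    hence "[(g, False)] \<in> words X" "inv\<^bsub>homeo_group\<^esub> h = word_map q [(g, False)]"
      using g by (auto simp: letter_map_def inv_homeo_group)
    thus ?case by blast
  next
    case (eng h1 h2)
    then obtain w1 w2 where "w1 \<in> words X" "w2 \<in> words X" "h1 = word_map q w1" "h2 = word_map q w2"
      by blast
    hence "w1 @ w2 \<in> words X" "h1 \<otimes>\<^bsub>homeo_group\<^esub> h2 = word_map q (w1 @ w2)" by auto
    thus ?case by blast
  qed
next
  fix h assume "h \<in> word_map q ` words X"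
  then obtain w where w: "w \<in> words X" "h = word_map q w" by blast
  have "word_map q w \<in> generate homeo_group (q ` X)" using w(1)
  proof (induction w)
    case Nil
    show ?case using generate.one[of homeo_group "q ` X"] by (simp add: id_def)
  next
    case (Cons l w)
    have "letter_map q l \<in> generate homeo_group (q ` X)"
    proof (cases "snd l")
      case True
      thus ?thesis using Cons.prems by (auto simp: letter_map_def intro: generate.incl)
    next
      case False
      have "q (fst l) \<in> q ` X" using Cons.prems by simp
      hence "inv\<^bsub>homeo_group\<^esub> (q (fst l)) \<in> generate homeo_group (q ` X)" "q (fst l) \<in> Homeo_plus"
        using assms by (auto intro: generate.inv)
      thus ?thesis using False by (simp add: letter_map_def inv_homeo_group)
    qed
    from generate.eng[OF this, of "word_map q w"] Cons show ?case by (simp add: comp_def)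
  qed
  thus "h \<in> generate homeo_group (q ` X)" using w by simp
qed

text \<open>Two words have equal values iff the first followed by the inverse of the second is
  trivial. So agreement on trivial words makes the passage between values both well defined and
  injective.\<close>

lemma iso_by_words:
  assumes q: "q ` X \<subseteq> Homeo_plus" and r: "r ` X \<subseteq> Homeo_plus"
    and same: "\<And>w. w \<in> words X \<Longrightarrow> word_map q w = id \<longleftrightarrow> word_map r w = id"
  shows "\<exists>\<phi>. \<phi> \<in> iso (gen_group (q ` X)) (gen_group (r ` X)) \<and> (\<forall>g\<in>X. \<phi> (q g) = r g)"
proof -
  have eq: "word_map q v = word_map q w \<longleftrightarrow> word_map r v = word_map r w"
    if "v \<in> words X" "w \<in> words X" for v w
  proof -
    have "word_map p v = word_map p w \<longleftrightarrow> word_map p (v @ word_inv w) = id"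
      if "p ` X \<subseteq> Homeo_plus" for p
      using word_map_word_inv[OF that \<open>w \<in> words X\<close>] by (auto simp: fun_eq_iff) metis
    from this[OF q] this[OF r] show ?thesis using same[of "v @ word_inv w"] that by simp
  qed
  \<comment> \<open>Any word for \<open>h\<close> will do, since \<open>eq\<close> makes the value
    of \<open>\<phi>\<close> independent of the choice.\<close>
  define W where "W h = (SOME w. w \<in> words X \<and> word_map q w = h)" for h
  define \<phi> where "\<phi> h = word_map r (W h)" for h
  have \<phi>: "\<phi> (word_map q w) = word_map r w" if "w \<in> words X" for w
  proof -
    have "W (word_map q w) \<in> words X \<and> word_map q (W (word_map q w)) = word_map q w"
      unfolding W_def by (rule someI[of _ w]) (simp add: that)
    thus ?thesis unfolding \<phi>_def using eq that by blast
  qed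
  have "\<phi> \<in> hom (gen_group (q ` X)) (gen_group (r ` X))"
  proof (rule homI)
    fix g h assume "g \<in> carrier (gen_group (q ` X))" "h \<in> carrier (gen_group (q ` X))"
    then obtain v w where vw: "v \<in> words X" "w \<in> words X" "g = word_map q v" "h = word_map q w"
      by (auto simp: gen_group_def generate_eq_word_maps[OF q])
    show "\<phi> (g \<otimes>\<^bsub>gen_group (q ` X)\<^esub> h) = \<phi> g \<otimes>\<^bsub>gen_group (r ` X)\<^esub> \<phi> h"
      using \<phi>[of "v @ w"] vw by (simp add: gen_group_def \<phi>)
  qed (auto simp: gen_group_def generate_eq_word_maps[OF q] generate_eq_word_maps[OF r] \<phi>)
  moreover have "bij_betw \<phi> (carrier (gen_group (q ` X))) (carrier (gen_group (r ` X)))"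
  proof (rule bij_betw_imageI)
    show "inj_on \<phi> (carrier (gen_group (q ` X)))"
      by (auto simp: inj_on_def gen_group_def generate_eq_word_maps[OF q] \<phi> eq)
    show "\<phi> ` carrier (gen_group (q ` X)) = carrier (gen_group (r ` X))"
      by (auto simp: gen_group_def generate_eq_word_maps[OF q] generate_eq_word_maps[OF r] \<phi> image_image
          cong: image_cong)
  qed
  moreover have "\<phi> (q g) = r g" if "g \<in> X" for g
    using \<phi>[of "[(g, True)]"] that by (simp add: letter_map_def)
  ultimately show ?thesis by (auto simp: iso_def)
qed

section \<open>Two-sided orbits indexed by the integers\<close>

lemma ex_int_orbit:
  assumes "h \<in> Homeo_plus"
  obtains z :: "int \<Rightarrow> real" where "z 0 = p" "\<And>i. h (z i) = z (i + 1)"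
proof -
  define z where "z i = (if 0 \<le> i then (h ^^ nat i) p else (hinv h ^^ nat (- i)) p)" for i :: int
  have "h (z i) = z (i + 1)" for i
  proof (cases "0 \<le> i")
    case True
    thus ?thesis by (simp add: z_def nat_add_distrib)
  next
    case False
    hence "nat (- i) = Suc (nat (- (i + 1)))" by simp
    hence "z i = hinv h ((hinv h ^^ nat (- (i + 1))) p)" using False by (simp add: z_def)
    hence "h (z i) = (hinv h ^^ nat (- (i + 1))) p" by (simp add: inv_apply_Homeo_plus[OF assms])
    also have "\<dots> = z (i + 1)" using False by (cases "i = -1") (simp_all add: z_def)
    finally show ?thesis .
  qed
  moreover have "z 0 = p" by (simp add: z_def)
  ultimately show thesis by (rule that[rotated])
qed

lemma orbit_in_supt:
  assumes "h \<in> Homeo_plus" "z 0 \<in> supt h" "\<And>i. h (z i) = z (i + 1)"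
  shows "z (i :: int) \<in> supt h"
proof -
  have step: "z (i + 1) \<in> supt h \<longleftrightarrow> z i \<in> supt h" for i
    using strict_mono_eq[OF Homeo_plus_strict_mono[OF assms(1)], of "z (i + 1)" "z i"]
    by (simp add: supt_def assms(3)[symmetric])
  show ?thesis
  proof (induction i rule: int_induct[where k = 0])
    case base show ?case by (rule assms(2))
  next
    case (step1 i) thus ?case by (simp add: step)
  next
    case (step2 i) thus ?case using step[of "i - 1"] by simp
  qed
qed

lemma bump_orbit_strict_mono:
  fixes z :: "int \<Rightarrow> real"
  assumes "positive_bump b" "z 0 \<in> supt b" "\<And>i. b (z i) = z (i + 1)"
  shows "strict_mono z"
proof -
  have "b \<in> Homeo_plus" using assms by (simp add: positive_bump_def bump_def)
  hence step: "z i < z (i + 1)" for i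
    using positive_bump_less(1)[OF assms(1) orbit_in_supt[of b z i]] assms(2,3) by simp
  have "z i < z (i + 1 + int n)" for i n
  proof (induction n)
    case 0 show ?case using step by simp
  next
    case (Suc n)
    thus ?case using step[of "i + 1 + int n"] by (simp add: add.commute add.left_commute)
  qed
  hence "z i < z j" if "i < j" for i j
    using that by (metis zless_iff_Suc_zadd int_Suc add.assoc add.commute)
  thus ?thesis by (simp add: strict_mono_def)
qed

section \<open>Excision of extraneous bumps\<close>

text \<open>The removed region \<open>V\<close> is an \<open>f\<close>-invariant union of intervals,
  so replacing \<open>f\<close> by the identity there does not disturb the order relative to points
  outside.\<close>

lemma quot_in_Homeo_plus:
  assumes f: "f \<in> Homeo_plus"
  shows "quot f E \<in> Homeo_plus"
proof -
  define V where "V = \<Union>{supt a | a. a \<in> E \<and> used_in a f}"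
  have q: "quot f E = (\<lambda>t. if t \<in> V then t else f t)" by (simp add: quot_def V_def)
  have V: "f t \<in> V \<longleftrightarrow> t \<in> V" for t
    using used_in_mem_supt_iff[OF _ f] by (auto simp: V_def)
  have hV: "hinv f t \<in> V \<longleftrightarrow> t \<in> V" for t
    using V[of "hinv f t"] by (simp add: inv_apply_Homeo_plus[OF f])
  have lt: "f s < f t \<longleftrightarrow> s < t" for s t by (rule Homeo_plus_less_iff[OF f])
  \<comment> \<open>\<open>s\<close> and its preimage lie in the same interval of \<open>V\<close>,
    which omits \<open>t\<close>, so both are on the same side of \<open>t\<close>.\<close>
  have conv: "hinv f s < t \<longleftrightarrow> s < t" "t < hinv f s \<longleftrightarrow> t < s" if V: "s \<in> V" "t \<notin> V" for s t
  proof -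
    obtain a where a: "a \<in> E" "used_in a f" "s \<in> supt a" using V(1) by (auto simp: V_def)
    have "t \<notin> supt a" using V(2) a by (auto simp: V_def)
    moreover have "hinv f s \<in> supt a"
      using a used_in_mem_supt_iff[OF a(2) f, of "hinv f s"] by (simp add: inv_apply_Homeo_plus[OF f])
    moreover obtain x y where "supt a = {x<..<y}"
      using a by (auto simp: used_in_def positive_bump_def bump_def)
    ultimately show "hinv f s < t \<longleftrightarrow> s < t" "t < hinv f s \<longleftrightarrow> t < s" using a(3) by auto
  qed
  have "quot f E s < quot f E t" if "s < t" for s t
    using that lt[of s t] conv[of s t] conv[of t s] lt[of "hinv f s" t] lt[of s "hinv f t"]
    by (auto simp: q inv_apply_Homeo_plus[OF f])
  moreover have "t \<in> range (quot f E)" for t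
  proof (cases "t \<in> V")
    case True
    hence "quot f E t = t" by (simp add: q)
    thus ?thesis by (rule range_eqI[OF sym])
  next
    case False
    hence "quot f E (hinv f t) = t" using hV by (simp add: q inv_apply_Homeo_plus[OF f])
    thus ?thesis by (rule range_eqI[OF sym])
  qed
  ultimately show ?thesis
    using f by (auto simp: Homeo_plus_iff strict_mono_def q)
qed

text \<open>Names the witnesses hidden in \<open>extraneous_witnessed\<close>: \<open>J_feet\<close>
  makes \<open>J\<close> a block for generators other than \<open>f\<close>, while \<open>b\<close>
  keeps powers of \<open>f\<close> visible after the excision.\<close>

locale extraneous_bumps =
  fixes X E :: "hom set" and m :: "hom \<Rightarrow> real" and J :: "real set" and f b :: hom and sb :: bool
  assumes X: "X \<subseteq> Homeo_plus" and fast: "geometrically_fast_with X m" and J: "is_interval J"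
    and fX: "f \<in> X"
    and E_used: "a \<in> E \<Longrightarrow> used_in a f" and E_J: "a \<in> E \<Longrightarrow> supt a \<subseteq> J"
    and b_used: "used_in b f" and b_E: "b \<notin> E" and b_J: "foot m b sb \<subseteq> J"
    and J_feet: "\<lbrakk>g \<in> X; g \<noteq> f; used_in a g\<rbrakk> \<Longrightarrow> foot m a s \<inter> J = {}"
begin

definition U :: "real set" where "U = \<Union> (supt ` E)"

abbreviation A :: "letter \<Rightarrow> hom" where "A \<equiv> letter_map (\<lambda>g. g)"
abbreviation B :: "letter \<Rightarrow> hom" where "B \<equiv> letter_map (\<lambda>g. quot g E)"

section \<open>Bumps and feet of the fast set relative to \<open>U\<close>\<close>

lemma Homeo_X: "g \<in> X \<Longrightarrow> g \<in> Homeo_plus"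
  using X by blast

lemma marker: "g \<in> X \<Longrightarrow> used_in a g \<Longrightarrow> m a \<in> supt a"
  using fast by (auto simp: geometrically_fast_with_def is_marking_def used_bumps_def)

lemma positive_bump_used: "used_in a g \<Longrightarrow> positive_bump a"
  by (simp add: used_in_def)

lemma feet_disjoint:
  "\<lbrakk>g \<in> X; h \<in> X; used_in a g; used_in c h; a \<noteq> c\<rbrakk> \<Longrightarrow> foot m a s \<inter> foot m c s' = {}"
  using fast unfolding geometrically_fast_with_def used_bumps_def by blast

text \<open>The left end of the support is a left transition point of every element using the bump,
  so geometric properness allows only one such element.\<close>

lemma used_in_unique:
  assumes "g \<in> X" "h \<in> X" "used_in a g" "used_in a h"
  shows "g = h"
proof (rule ccontr)
  assume ne: "g \<noteq> h"
  define x y where "x = Inf (supt a)" and "y = Sup (supt a)"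
  have p: "positive_bump a" using assms by (simp add: used_in_def)
  have s: "supt a = {x<..<y}" "x < y" using positive_bump_supt[OF p] by (simp_all add: x_def y_def)
  have x01: "x \<in> {0..1}"
  proof -
    have "t \<in> {0..1}" if "t \<in> {x<..<y}" for t
      using that used_in_Homeo_plus[OF assms(3)] unfolding s(1)[symmetric]
      by (auto simp: supt_def Homeo_plus_iff)
    hence "{x<..<y} \<subseteq> {0..1}" by blast
    hence "closure {x<..<y} \<subseteq> {0..1}" by (rule closure_minimal) simp
    thus ?thesis using s(2) by auto
  qed
  have "left_transition_point k x" if "k \<in> X" "used_in a k" for k
  proof -
    have k: "k \<in> Homeo_plus" using that Homeo_X by blast
    have "k x = x" using used_in_endpoints_fixed(1)[OF that(2) k] by (simp add: x_def)
    moreover have "{x<..<x + \<epsilon>} \<inter> supt k \<noteq> {}" if \<epsilon>: "\<epsilon> > 0" for \<epsilon>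
    proof -
      obtain t where "x < t" "t < min (x + \<epsilon>) y"
        using dense[of x "min (x + \<epsilon>) y"] s(2) \<epsilon> by auto
      hence "t \<in> {x<..<x + \<epsilon>}" "t \<in> supt a" using s by auto
      thus ?thesis using used_in_supt_subset[OF \<open>used_in a k\<close> k] by blast
    qed
    ultimately show ?thesis using x01 by (simp add: left_transition_point_def supt_def)
  qed
  thus False
    using ne assms fast unfolding geometrically_fast_with_def geometrically_proper_def by blast
qed

text \<open>Overlapping supports coincide, so both left feet start at the same point and meet;
  fastness forbids this for distinct bumps.\<close>

lemma used_in_same_eq:
  assumes "g \<in> X" "used_in a g" "used_in c g" "supt a \<inter> supt c \<noteq> {}"
  shows "a = c"
proof (rule ccontr)
  assume ne: "a \<noteq> c"
  have s: "supt a = supt c" using used_in_supt_eq assms Homeo_X by blast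
  define x where "x = Inf (supt a)"
  have p: "positive_bump a" using assms by (simp add: used_in_def)
  have "x < m a" "x < m c"
    using marker[OF assms(1,2)] marker[OF assms(1,3)] positive_bump_supt(1)[OF p] s
    unfolding x_def by auto
  then obtain t where "x < t" "t < min (m a) (m c)" using dense[of x "min (m a) (m c)"] by auto
  hence "t \<in> foot m a True \<inter> foot m c True"
    using s by (simp add: foot_def left_foot_def x_def)
  thus False using feet_disjoint[OF assms(1,1,2,3) ne] by blast
qed

lemma U_J: "U \<subseteq> J"
  using E_J by (auto simp: U_def)

lemma disjoint_U:
  assumes "used_in c f" "c \<notin> E"
  shows "supt c \<inter> U = {}"
proof -
  have "supt c \<inter> supt a = {}" if "a \<in> E" for a
    using used_in_same_eq[OF fX assms(1) E_used[OF that]] assms(2) that by blast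
  thus ?thesis unfolding U_def by blast
qed

text \<open>For \<open>f\<close> this is disjointness of its orbitals; the feet of any other
  generator avoid all of \<open>J\<close>, which contains \<open>U\<close>.\<close>

lemma foot_disjoint_U:
  assumes "g \<in> X" "used_in c g" "c \<notin> E"
  shows "foot m c s \<inter> U = {}"
proof (cases "g = f")
  case True
  thus ?thesis
    using disjoint_U[of c] assms
      foot_subset_supt[where m = m, OF positive_bump_used[OF assms(2)] marker[OF assms(1,2)]] by blast
next
  case False
  thus ?thesis using J_feet[OF assms(1) False assms(2)] U_J by blast
qed

lemma quot_other:
  assumes "g \<in> X" "g \<noteq> f"
  shows "quot g E = g"
proof -
  have "\<not> used_in a g" if "a \<in> E" for a
    using used_in_unique[OF assms(1) fX _ E_used[OF that]] assms(2) by blast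
  hence none: "{supt a | a. a \<in> E \<and> used_in a g} = {}" by blast
  show ?thesis unfolding quot_def none by simp
qed

lemma quot_f: "quot f E t = (if t \<in> U then t else f t)"
proof -
  have "{supt a | a. a \<in> E \<and> used_in a f} = supt ` E" using E_used by blast
  thus ?thesis unfolding quot_def U_def by simp
qed

lemma f_U: "f t \<in> U \<longleftrightarrow> t \<in> U"
  using used_in_mem_supt_iff[OF E_used Homeo_X[OF fX]] unfolding U_def by blast

text \<open>Inverse letters are covered because \<open>U\<close> is invariant under
  \<open>f\<close>, so the preimage of a point off \<open>U\<close> is off \<open>U\<close>
  too.\<close>

lemma B_eq_A_off_U:
  assumes "fst l \<in> X" "t \<notin> U"
  shows "B l t = A l t"
proof (cases "fst l = f")
  case True
  have f: "f \<in> Homeo_plus" using Homeo_X fX by blast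
  have q: "quot f E \<in> Homeo_plus" by (rule quot_in_Homeo_plus[OF f])
  have "hinv f t \<notin> U" using f_U[of "hinv f t"] assms by (simp add: inv_apply_Homeo_plus[OF f])
  hence "quot f E (hinv f t) = t" by (simp add: quot_f inv_apply_Homeo_plus[OF f])
  hence "hinv (quot f E) t = hinv f t" using inv_apply_Homeo_plus(1)[OF q, of "hinv f t"] by simp
  thus ?thesis using True assms by (simp add: letter_map_def quot_f)
next
  case False
  thus ?thesis using quot_other assms by (simp add: letter_map_def)
qed

lemma B_eq_A_other: "fst l \<in> X \<Longrightarrow> fst l \<noteq> f \<Longrightarrow> B l = A l"
  by (simp add: letter_map_def quot_other)

section \<open>Trails: carrying \<open>J\<close> from foot to foot\<close>

definition acts :: "letter \<Rightarrow> hom \<Rightarrow> bool \<Rightarrow> bool" where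
  "acts l d s \<longleftrightarrow> used_in d (fst l) \<and> (\<forall>t\<in>supt d. A l t = (if s then hinv d t else d t))"

text \<open>The flag of \<open>acts\<close> is also the index of the foot towards which the letter
  pushes: \<open>True\<close> means the inverse of \<open>d\<close>, hence the left foot. Inverting
  the letter flips it.\<close>

lemma ex_acts:
  assumes "fst l \<in> X" "used_in d (fst l)"
  obtains s where "acts l d s"
proof -
  obtain e where e: "\<And>t. t \<in> supt d \<Longrightarrow> fst l t = (if e then hinv d t else d t)"
    "\<And>t. t \<in> supt d \<Longrightarrow> hinv (fst l) t = (if e then d t else hinv d t)"
    using used_inE[OF assms(2) Homeo_X[OF assms(1)]] by blast
  show thesis
    by (rule that[of "if snd l then e else \<not> e"]) (use assms e in \<open>auto simp: acts_def letter_map_def\<close>)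
qed

text \<open>\<^term>\<open>trail \<sigma> c s\<close> says that \<^term>\<open>\<sigma>\<close>, read from its last letter to its first, is a
  word without local cancellation which carries \<^term>\<open>J\<close> from foot to foot and finally into the foot
  \<^term>\<open>foot m c s\<close> of a bump used in its head letter.\<close>
inductive trail :: "letter list \<Rightarrow> hom \<Rightarrow> bool \<Rightarrow> bool" where
  start: "\<lbrakk>fst l \<in> X; fst l \<noteq> f; acts l d s; J \<subseteq> {m d..<d (m d)}\<rbrakk> \<Longrightarrow> trail [l] d s"
| again: "trail (l # \<sigma>) d s \<Longrightarrow> trail (l # l # \<sigma>) d s"
| enter: "\<lbrakk>trail (l' # \<sigma>) c s'; fst l \<in> X; fst l \<noteq> fst l'; acts l d s;
           foot m c s' \<subseteq> {m d..<d (m d)}\<rbrakk> \<Longrightarrow> trail (l # l' # \<sigma>) d s"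

lemma trail_step:
  assumes "fst l \<in> X" "acts l d s"
  shows "t \<in> {m d..<d (m d)} \<Longrightarrow> A l t \<in> foot m d s"
    and "t \<in> foot m d s \<Longrightarrow> A l t \<in> foot m d s"
proof -
  have u: "used_in d (fst l)" using assms by (simp add: acts_def)
  note ff = positive_bump_used[OF u] marker[OF assms(1) u]
  have e: "A l t = (if s then hinv d t else d t)" if "t \<in> supt d"
    using assms that by (simp add: acts_def)
  show "A l t \<in> foot m d s" if "t \<in> {m d..<d (m d)}"
  proof -
    have "t \<in> supt d" using that middle_subset_supt[where m = m, OF ff] by blast
    thus ?thesis using e middle_to_foot[where m = m, OF ff that] by simp
  qed
  show "A l t \<in> foot m d s" if "t \<in> foot m d s"
  proof -
    have "t \<in> supt d" using that foot_subset_supt[where m = m, OF ff] by blast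
    thus ?thesis using e foot_invariant[where m = m, OF ff that] by simp
  qed
qed

text \<open>The last foot never belongs to a bump of \<open>E\<close>, so trails end off
  \<open>U\<close>, where both actions agree. The tail is returned as a trail because a later letter
  may cancel the head.\<close>

lemma trail_facts:
  assumes "trail \<sigma> c s"
  obtains l \<sigma>' where "\<sigma> = l # \<sigma>'" "fst l \<in> X" "acts l c s" "c \<notin> E"
    "\<And>p. p \<in> J \<Longrightarrow> foldr A \<sigma> p \<in> foot m c s"
    "\<sigma>' = [] \<or> (\<exists>c' s'. trail \<sigma>' c' s')"
proof -
  have "\<exists>l \<sigma>'. \<sigma> = l # \<sigma>' \<and> fst l \<in> X \<and> acts l c s \<and> c \<notin> E \<and>
    (\<forall>p\<in>J. foldr A \<sigma> p \<in> foot m c s) \<and> (\<sigma>' = [] \<or> (\<exists>c' s'. trail \<sigma>' c' s'))"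
    using assms
  proof induction
    case (start l d s)
    have "d \<notin> E" using used_in_unique[OF start(1) fX _ E_used] start(2,3) by (auto simp: acts_def)
    moreover have "\<forall>p\<in>J. foldr A [l] p \<in> foot m d s"
      using trail_step(1)[OF start(1,3)] start(4) by auto
    ultimately show ?case using start by blast
  next
    case (again l \<sigma> d s)
    hence l: "fst l \<in> X" "acts l d s" "d \<notin> E" "\<And>p. p \<in> J \<Longrightarrow> foldr A (l # \<sigma>) p \<in> foot m d s" by auto
    have "\<forall>p\<in>J. foldr A (l # l # \<sigma>) p \<in> foot m d s"
      using trail_step(2)[OF l(1,2)] l(4) by simp
    thus ?case using again.hyps l by blast
  next
    case (enter l' \<sigma> c s' l d s)
    hence l': "fst l' \<in> X" "acts l' c s'" "\<And>p. p \<in> J \<Longrightarrow> foldr A (l' # \<sigma>) p \<in> foot m c s'" by auto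
    have c: "used_in c (fst l')" using l' by (simp add: acts_def)
    have d: "used_in d (fst l)" using enter by (simp add: acts_def)
    have "d \<notin> E"
    proof
      \<comment> \<open>Such a \<open>d\<close> is used in \<open>f\<close> and would enclose the
        previous foot in \<open>supt d \<subseteq> J\<close>, although that foot belongs to another
        generator and so avoids \<open>J\<close>.\<close>
      assume dE: "d \<in> E"
      hence lf: "fst l = f" using used_in_unique[OF enter(2) fX d E_used] by blast
      hence "foot m c s' \<inter> J = {}" using J_feet[OF l'(1) _ c] enter(3) by simp
      moreover have "foot m c s' \<subseteq> J"
        using enter(5) middle_subset_supt[where m = m, OF positive_bump_used[OF d] marker[OF enter(2) d]] E_J[OF dE]
        by blast
      ultimately show False
        using foot_nonempty[where m = m, OF positive_bump_used[OF c] marker[OF l'(1) c]] by blast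
    qed
    moreover have "\<forall>p\<in>J. foldr A (l # l' # \<sigma>) p \<in> foot m d s"
      using trail_step(1)[OF enter(2,4)] subsetD[OF enter(5) l'(3)] by simp
    ultimately show ?case using enter by blast
  qed
  thus thesis using that by blast
qed

lemma A_fixes: "fst l \<in> X \<Longrightarrow> t \<notin> supt (fst l) \<Longrightarrow> A l t = t"
  using inv_apply_Homeo_plus(1)[OF Homeo_X, of "fst l" t] by (simp add: letter_map_def supt_def)

text \<open>\<^term>\<open>\<sigma>\<close> and \<^term>\<open>k\<close> depend on the word only, so that the actions of \<open>X\<close> and
  \<open>X/E\<close> can be compared, and points of \<^term>\<open>U\<close> with points of a foot inside \<^term>\<open>J\<close>.\<close>
lemma word_trail:
  assumes "w \<in> words X"
  shows "\<exists>\<sigma> k. (\<sigma> = [] \<or> (\<exists>c s. trail \<sigma> c s)) \<and> \<bar>k\<bar> \<le> int (length w) \<and>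
    (\<forall>C pos. C \<in> {A, B} \<longrightarrow> (\<forall>j. \<bar>j\<bar> \<le> int (length w) \<longrightarrow> pos j \<in> J) \<longrightarrow>
      (\<forall>j. C (f, True) (pos j) = pos (j + 1) \<and> C (f, False) (pos j) = pos (j - 1)) \<longrightarrow>
      fold C w (pos 0) = foldr A \<sigma> (pos k))"
  using assms
proof (induction w rule: rev_induct)
  case Nil
  show ?case by (intro exI[of _ "[]"] exI[of _ 0]) simp
next
  case (snoc l w)
  \<comment> \<open>\<open>pos\<close> parametrises points on which \<open>f\<close> shifts the
    index; it may be constant, as for \<open>B\<close> on \<open>U\<close>. Each letter changes the
    index by at most one, so the window of radius \<open>n\<close> suffices.\<close>
  define good where "good C pos n \<longleftrightarrow> C \<in> {A, B} \<and> (\<forall>j. \<bar>j\<bar> \<le> int n \<longrightarrow> pos j \<in> J) \<and>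
      (\<forall>j. C (f, True) (pos j) = pos (j + 1) \<and> C (f, False) (pos j) = pos (j - 1))"
    for C :: "letter \<Rightarrow> hom" and pos :: "int \<Rightarrow> real" and n :: nat
  have l: "fst l \<in> X" "w \<in> words X" using snoc.prems by auto
  obtain \<sigma> k where \<sigma>: "\<sigma> = [] \<or> (\<exists>c s. trail \<sigma> c s)" and k: "\<bar>k\<bar> \<le> int (length w)"
    and IH: "\<And>C pos. good C pos (length w) \<Longrightarrow> fold C w (pos 0) = foldr A \<sigma> (pos k)"
    using snoc.IH[OF l(2)] unfolding good_def by blast
  have IH': "fold C (w @ [l]) (pos 0) = C l (foldr A \<sigma> (pos k))" and posk: "pos k \<in> J"
    and CAB: "C \<in> {A, B}"
    if "good C pos (length (w @ [l]))" for C pos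
  proof -
    have "good C pos (length w)" using that by (simp add: good_def)
    thus "fold C (w @ [l]) (pos 0) = C l (foldr A \<sigma> (pos k))" using IH by simp
    show "pos k \<in> J" "C \<in> {A, B}" using that k by (auto simp: good_def)
  qed
  have "\<exists>\<sigma>' k'. (\<sigma>' = [] \<or> (\<exists>c s. trail \<sigma>' c s)) \<and> \<bar>k'\<bar> \<le> int (length (w @ [l])) \<and>
    (\<forall>C pos. good C pos (length (w @ [l])) \<longrightarrow> C l (foldr A \<sigma> (pos k)) = foldr A \<sigma>' (pos k'))"
  proof (cases "\<sigma> = []")
    case True
    show ?thesis
    proof (cases "fst l = f")
      case lf: True
      define k' where "k' = (if snd l then k + 1 else k - 1)"
      have "C l (pos k) = pos k'" if "good C pos (length (w @ [l]))" for C pos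
        using that lf by (cases l) (auto simp: good_def k'_def)
      moreover have "\<bar>k'\<bar> \<le> int (length (w @ [l]))" using k by (auto simp: k'_def)
      ultimately show ?thesis
        using True by (intro exI[of _ "[]"] exI[of _ k']) simp
    next
      case lf: False
      have C: "C l = A l" if "good C pos (length (w @ [l]))" for C pos
        using CAB[OF that] B_eq_A_other[OF l(1) lf] by auto
      \<comment> \<open>No foot has been entered yet: this generator either fixes \<open>J\<close>
        pointwise or starts a trail by throwing all of \<open>J\<close> into a foot.\<close>
      have "J \<inter> supt (fst l) = {} \<or> (\<exists>d. used_in d (fst l) \<and> J \<subseteq> {m d..<d (m d)})"
        using J_feet[OF l(1) lf] marker[OF l(1)]
        by (intro interval_avoiding_feet[OF Homeo_X[OF l(1)] J])
      thus ?thesis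
      proof
        assume "J \<inter> supt (fst l) = {}"
        hence "C l (pos k) = pos k" if "good C pos (length (w @ [l]))" for C pos
          using C[OF that] A_fixes[OF l(1)] posk[OF that] by auto
        thus ?thesis using True k by (intro exI[of _ "[]"] exI[of _ k]) simp
      next
        assume "\<exists>d. used_in d (fst l) \<and> J \<subseteq> {m d..<d (m d)}"
        then obtain d where d: "used_in d (fst l)" "J \<subseteq> {m d..<d (m d)}" by blast
        then obtain s where "acts l d s" using ex_acts[OF l(1)] by blast
        hence "trail [l] d s" using start l(1) lf d(2) by blast
        thus ?thesis using True k C by (intro exI[of _ "[l]"] exI[of _ k]) auto
      qed
    qed
  next
    case False
    then obtain c s where tr: "trail \<sigma> c s" using \<sigma> by blast
    then obtain l0 \<sigma>0 where l0: "\<sigma> = l0 # \<sigma>0" "fst l0 \<in> X" "acts l0 c s" "c \<notin> E"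
      and im: "\<And>p. p \<in> J \<Longrightarrow> foldr A \<sigma> p \<in> foot m c s"
      and \<sigma>0: "\<sigma>0 = [] \<or> (\<exists>c' s'. trail \<sigma>0 c' s')"
      by (rule trail_facts) (rule that)
    have c: "used_in c (fst l0)" using l0 by (simp add: acts_def)
    \<comment> \<open>The current point lies in a foot off \<open>U\<close>, so the next letter acts
      alike in both actions.\<close>
    have C: "C l (foldr A \<sigma> (pos k)) = A l (foldr A \<sigma> (pos k))"
      if "good C pos (length (w @ [l]))" for C pos
    proof -
      have "foldr A \<sigma> (pos k) \<notin> U"
        using im[OF posk[OF that]] foot_disjoint_U[OF l0(2) c l0(4)] by blast
      thus ?thesis using B_eq_A_off_U[OF l(1)] CAB[OF that] by auto
    qed
    \<comment> \<open>The inverse of the head letter removes it, a repetition stays in the same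
      foot, and another generator fixes the foot or throws it into one of its own feet.\<close>
    consider (cancel) "l = (fst l0, \<not> snd l0)" | (same) "l = l0" | (other) "fst l \<noteq> fst l0"
      by (cases l; cases l0) auto
    thus ?thesis
    proof cases
      case cancel
      have "A l (A l0 t) = t" for t
        using letter_map_cancel[of "\<lambda>g. g" "fst l0" "snd l0" t] Homeo_X[OF l0(2)] cancel by simp
      thus ?thesis using C \<sigma>0 k l0(1) by (intro exI[of _ \<sigma>0] exI[of _ k]) auto
    next
      case same
      have "trail (l # \<sigma>) c s" using again tr same l0(1) by blast
      thus ?thesis using C k by (intro exI[of _ "l # \<sigma>"] exI[of _ k]) auto
    next
      case other
      have "foot m a s' \<inter> foot m c s = {}" if "used_in a (fst l)" for a s'
        using feet_disjoint[OF l(1) l0(2) that c] used_in_unique[OF l(1) l0(2) that] c other by blast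
      hence "foot m c s \<inter> supt (fst l) = {} \<or>
          (\<exists>d. used_in d (fst l) \<and> foot m c s \<subseteq> {m d..<d (m d)})"
        using marker[OF l(1)]
        by (intro interval_avoiding_feet[OF Homeo_X[OF l(1)]]
              foot_interval[where m = m, OF positive_bump_used[OF c] marker[OF l0(2) c]])
      thus ?thesis
      proof
        assume "foot m c s \<inter> supt (fst l) = {}"
        hence "A l (foldr A \<sigma> (pos k)) = foldr A \<sigma> (pos k)"
          if "good C pos (length (w @ [l]))" for C pos
          using A_fixes[OF l(1)] im[OF posk[OF that]] by blast
        thus ?thesis using \<sigma> k C by (intro exI[of _ \<sigma>] exI[of _ k]) auto
      next
        assume "\<exists>d. used_in d (fst l) \<and> foot m c s \<subseteq> {m d..<d (m d)}"
        then obtain d where d: "used_in d (fst l)" "foot m c s \<subseteq> {m d..<d (m d)}" by blast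
        then obtain s' where "acts l d s'" using ex_acts[OF l(1)] by blast
        hence "trail (l # \<sigma>) d s'" using enter tr l0(1) l(1) other d(2) by blast
        thus ?thesis using C k by (intro exI[of _ "l # \<sigma>"] exI[of _ k]) auto
      qed
    qed
  qed
  then obtain \<sigma>' k' where *: "\<sigma>' = [] \<or> (\<exists>c s. trail \<sigma>' c s)" "\<bar>k'\<bar> \<le> int (length (w @ [l]))"
    "\<And>C pos. good C pos (length (w @ [l])) \<Longrightarrow> C l (foldr A \<sigma> (pos k)) = foldr A \<sigma>' (pos k')"
    by blast
  show ?case
  proof (intro exI[of _ \<sigma>'] exI[of _ k'] conjI allI impI)
    fix C :: "letter \<Rightarrow> hom" and pos :: "int \<Rightarrow> real"
    assume "C \<in> {A, B}" "\<forall>j. \<bar>j\<bar> \<le> int (length (w @ [l])) \<longrightarrow> pos j \<in> J"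
      "\<forall>j. C (f, True) (pos j) = pos (j + 1) \<and> C (f, False) (pos j) = pos (j - 1)"
    hence "good C pos (length (w @ [l]))" by (simp add: good_def)
    from IH'[OF this] *(3)[OF this] show "fold C (w @ [l]) (pos 0) = foldr A \<sigma>' (pos k')" by simp
  qed (use *(1,2) in blast)+
qed

section \<open>Comparing the two actions at points of \<open>U\<close>\<close>

lemma trail_leaves_U:
  assumes "trail \<sigma> c s" "p \<in> J"
  shows "foldr A \<sigma> p \<notin> U"
proof -
  obtain l \<sigma>' where l: "fst l \<in> X" "acts l c s" "c \<notin> E"
    and im: "\<And>p. p \<in> J \<Longrightarrow> foldr A \<sigma> p \<in> foot m c s"
    by (rule trail_facts[OF assms(1)]) (rule that)
  have "used_in c (fst l)" using l(2) by (simp add: acts_def)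
  thus ?thesis using foot_disjoint_U[OF l(1) _ l(3)] im[OF assms(2)] by blast
qed

lemma orbit_steps:
  assumes "\<And>j. f (pos j) = pos (j + 1 :: int)"
  shows "A (f, True) (pos j) = pos (j + 1)" "A (f, False) (pos j) = pos (j - 1)"
  using assms inv_apply_Homeo_plus(1)[OF Homeo_X[OF fX], of "pos (j - 1)"]
  by (simp_all add: letter_map_def)

text \<open>The trail statement is used twice with the same \<open>\<sigma>\<close> and
  \<open>k\<close>: along the \<open>f\<close>-orbit of \<open>p\<close> for \<open>A\<close>, and
  along the constant sequence \<open>p\<close> for \<open>B\<close>, since the excised
  \<open>f\<close> fixes \<open>U\<close>.\<close>

lemma fold_A_B_on_U:
  assumes "p \<in> U" "\<And>j. f (pos j) = pos (j + 1 :: int)" "pos 0 = p"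
    and tr: "\<forall>C pos. C \<in> {A, B} \<longrightarrow> (\<forall>j. \<bar>j\<bar> \<le> int (length w) \<longrightarrow> pos j \<in> J) \<longrightarrow>
      (\<forall>j. C (f, True) (pos j) = pos (j + 1) \<and> C (f, False) (pos j) = pos (j - 1)) \<longrightarrow>
      fold C w (pos 0) = foldr A \<sigma> (pos k)"
  shows "pos j \<in> J" "fold A w p = foldr A \<sigma> (pos k)" "fold B w p = foldr A \<sigma> p"
proof -
  have step: "pos (j + 1) \<in> U \<longleftrightarrow> pos j \<in> U" for j using f_U[of "pos j"] assms(2) by simp
  have "pos j \<in> U" for j
  proof (induction j rule: int_induct[where k = 0])
    case base show ?case using assms by simp
  next
    case (step1 i) thus ?case by (simp add: step)
  next
    case (step2 i) thus ?case using step[of "i - 1"] by simp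
  qed
  thus pJ: "pos j \<in> J" for j using U_J by blast
  show "fold A w p = foldr A \<sigma> (pos k)"
    using tr[rule_format, of A pos] pJ orbit_steps[of pos] assms by simp
  have q: "quot f E p = p" using assms by (simp add: quot_f)
  hence "hinv (quot f E) p = p"
    using inv_apply_Homeo_plus(1)[OF quot_in_Homeo_plus[OF Homeo_X[OF fX]], of E p] by simp
  with q show "fold B w p = foldr A \<sigma> p"
    using tr[rule_format, of B "\<lambda>_. p"] U_J assms(1) by (auto simp: letter_map_def)
qed

text \<open>Near the end of \<^term>\<open>b\<close> lying in the closure of \<^term>\<open>J\<close>, arbitrarily long segments of an
  orbit of \<^term>\<open>f\<close> stay in \<^term>\<open>J\<close>.\<close>
lemma ex_long_orbit_in_foot:
  obtains pos :: "int \<Rightarrow> real" where "inj pos" "\<And>j. \<bar>j\<bar> \<le> int n \<Longrightarrow> pos j \<in> J"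
    "\<And>j. pos j \<in> supt b" "\<And>j. f (pos j) = pos (j + 1)"
proof -
  have p: "positive_bump b" by (rule positive_bump_used[OF b_used])
  have bH: "b \<in> Homeo_plus" by (rule used_in_Homeo_plus[OF b_used])
  have mb: "m b \<in> supt b" by (rule marker[OF fX b_used])
  obtain z :: "int \<Rightarrow> real" where z0: "z 0 = m b" and z: "\<And>i. b (z i) = z (i + 1)" using ex_int_orbit[OF bH] by blast
  have zs: "z i \<in> supt b" for i using orbit_in_supt[OF bH] z0 z mb by simp
  have zm: "strict_mono z" using bump_orbit_strict_mono[OF p] z0 z mb by simp
  have zinv: "hinv b (z i) = z (i - 1)" for i
    using inv_apply_Homeo_plus(1)[OF bH, of "z (i - 1)"] z by simp
  have zb: "Inf (supt b) < z i" "z i < Sup (supt b)" for i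
    using zs[of i] positive_bump_supt(1)[OF p] by auto
  \<comment> \<open>The window of radius \<open>n\<close> around \<open>i0\<close> stays at indices
    at most \<open>-1\<close> for the left foot and at least \<open>1\<close> for the right;
    \<open>z 0\<close> is the marker, which lies in neither foot.\<close>
  define i0 :: int where "i0 = (if sb then - int n - 1 else int n + 1)"
  have zJ: "z i \<in> J" if "\<bar>i - i0\<bar> \<le> int n" for i
  proof -
    have "z i < z 0" if "i < 0" using zm that by (simp add: strict_mono_less)
    moreover have "z 1 \<le> z i" if "1 \<le> i" using zm that by (simp add: strict_mono_less_eq)
    moreover have "z 1 = b (m b)" using z[of 0] z0 by simp
    ultimately have "z i \<in> foot m b sb"
      using that zb[of i] z0
      by (auto simp: foot_def left_foot_def right_foot_def i0_def split: if_splits)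
    thus ?thesis using b_J by blast
  qed
  obtain e where e: "\<And>t. t \<in> supt b \<Longrightarrow> f t = (if e then hinv b t else b t)"
    by (rule used_inE[OF b_used Homeo_X[OF fX]]) (rule that)
  \<comment> \<open>When \<open>f\<close> runs through \<open>b\<close> backwards, the orbit of
    \<open>b\<close> is traversed in reverse.\<close>
  define pos where "pos j = z (if e then i0 - j else i0 + j)" for j
  have "inj pos"
    using zm by (auto simp: inj_def pos_def strict_mono_eq)
  moreover have "pos j \<in> J" if "\<bar>j\<bar> \<le> int n" for j
    using zJ[of "i0 - j"] zJ[of "i0 + j"] that by (simp add: pos_def)
  moreover have "pos j \<in> supt b" for j by (simp add: pos_def zs)
  moreover have "f (pos j) = pos (j + 1)" for j
    using e[OF zs] by (simp add: pos_def z zinv algebra_simps)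
  ultimately show thesis by (rule that)
qed

text \<open>With a nonempty trail both actions carry \<open>p\<close> out of \<open>U\<close>, so
  neither word map is trivial. With an empty one \<open>B\<close> fixes \<open>p\<close> and
  \<open>A\<close> shifts it by \<open>k\<close> steps of \<open>f\<close>, so only
  \<open>k = 0\<close> remains to be shown.\<close>

lemma word_id_on_U:
  assumes w: "w \<in> words X" and p: "p \<in> U"
  shows "fold A w = id \<Longrightarrow> fold B w p = p" "fold B w = id \<Longrightarrow> fold A w p = p"
proof -
  obtain \<sigma> k where \<sigma>: "\<sigma> = [] \<or> (\<exists>c s. trail \<sigma> c s)" and k: "\<bar>k\<bar> \<le> int (length w)"
    and tr: "\<forall>C pos. C \<in> {A, B} \<longrightarrow> (\<forall>j. \<bar>j\<bar> \<le> int (length w) \<longrightarrow> pos j \<in> J) \<longrightarrow>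
      (\<forall>j. C (f, True) (pos j) = pos (j + 1) \<and> C (f, False) (pos j) = pos (j - 1)) \<longrightarrow>
      fold C w (pos 0) = foldr A \<sigma> (pos k)"
    using word_trail[OF w] by blast
  obtain pos :: "int \<Rightarrow> real" where pos: "pos 0 = p" "\<And>j. f (pos j) = pos (j + 1)"
    using ex_int_orbit[OF Homeo_X[OF fX]] by blast
  note U = fold_A_B_on_U[OF p pos(2,1) tr]
  have out: "foldr A \<sigma> t \<noteq> p" if "\<sigma> \<noteq> []" "t \<in> J" for t
    using trail_leaves_U that \<sigma> p by blast
  show "fold B w p = p" if "fold A w = id"
    using U(2,3) out[OF _ U(1)] that by (cases "\<sigma> = []") auto
  show "fold A w p = p" if id: "fold B w = id"
  proof -
    have \<sigma>0: "\<sigma> = []" using out[of p] U(3) id p U_J by auto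
    obtain pos' :: "int \<Rightarrow> real" where pos': "inj pos'" "\<And>j. \<bar>j\<bar> \<le> int (length w) \<Longrightarrow> pos' j \<in> J"
      "\<And>j. pos' j \<in> supt b" "\<And>j. f (pos' j) = pos' (j + 1)"
      using ex_long_orbit_in_foot by blast
    \<comment> \<open>On the support of \<open>b\<close> the excised letters still act as
      \<open>f\<close> does, so the word shifts this orbit by the same \<open>k\<close>; triviality
      and injectivity of \<open>pos'\<close> force \<open>k = 0\<close>.\<close>
    have "pos' j \<notin> U" for j using disjoint_U[OF b_used b_E] pos'(3)[of j] by blast
    hence "B (f, e) (pos' j) = A (f, e) (pos' j)" for e j using B_eq_A_off_U[of "(f, e)"] fX by simp
    hence "fold B w (pos' 0) = pos' k"
      using tr[rule_format, of B pos'] pos'(2) orbit_steps[of pos'] pos'(4) \<sigma>0 by simp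
    hence "k = 0" using id pos'(1) by (auto simp: inj_def)
    thus ?thesis using U(2) \<sigma>0 pos by simp
  qed
qed

section \<open>From points of \<open>U\<close> to all points\<close>

lemma fold_eq_off_U:
  assumes CD: "\<And>l t. fst l \<in> X \<Longrightarrow> t \<notin> U \<Longrightarrow> C l t = D l t"
    and "w \<in> words X" "\<And>u v. w = u @ v \<Longrightarrow> fold C u s \<notin> U"
  shows "fold C w s = fold D w s"
  using assms(2,3)
proof (induction w rule: rev_induct)
  case (snoc l w)
  have "fold C w s \<notin> U" using snoc.prems(2)[of w "[l]"] by simp
  moreover have "fold C w s = fold D w s"
  proof (rule snoc.IH)
    show "w \<in> words X" using snoc.prems(1) by simp
    show "fold C u s \<notin> U" if "w = u @ v" for u v
      using snoc.prems(2)[of u "v @ [l]"] that by simp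
  qed
  ultimately show ?case using CD[of l "fold C w s"] snoc.prems(1) by simp
qed simp

text \<open>If an orbit segment meets \<^term>\<open>U\<close>, conjugating the word (a cyclic permutation of its letters)
  makes it start in \<^term>\<open>U\<close>.\<close>
lemma word_map_id_transfer:
  assumes q: "q ` X \<subseteq> Homeo_plus" and r: "r ` X \<subseteq> Homeo_plus"
    and off: "\<And>l t. fst l \<in> X \<Longrightarrow> t \<notin> U \<Longrightarrow> letter_map q l t = letter_map r l t"
    and on: "\<And>w p. w \<in> words X \<Longrightarrow> p \<in> U \<Longrightarrow> word_map r w = id \<Longrightarrow> word_map q w p = p"
    and w: "w \<in> words X" and id: "word_map r w = id"
  shows "word_map q w = id"
proof (rule ext)
  fix s
  show "word_map q w s = id s"
  proof (cases "\<exists>u v. w = u @ v \<and> word_map q u s \<in> U")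
    case False
    have "word_map q w s = word_map r w s"
    proof (rule fold_eq_off_U[OF _ w])
      show "word_map q u s \<notin> U" if "w = u @ v" for u v using False that by blast
    qed (rule off)
    thus ?thesis using id by simp
  next
    case True
    then obtain u v where uv: "w = u @ v" "word_map q u s \<in> U" by blast
    have u: "u \<in> words X" and v: "v \<in> words X" using w uv by auto
    \<comment> \<open>As \<open>u @ v\<close> is trivial, \<open>v\<close> acts as the inverse of
      \<open>u\<close>, and the cyclic permutation \<open>v @ u\<close> is trivial too.\<close>
    have "word_map r v (word_map r u t) = t" for t using id uv by (auto simp: fun_eq_iff)
    from this[of "word_map r (word_inv u) t" for t]
    have "word_map r v t = word_map r (word_inv u) t" for t
      by (simp add: word_map_word_inv(2)[OF r u])
    hence vu: "word_map r (v @ u) = id" by (auto simp: fun_eq_iff word_map_word_inv(2)[OF r u])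
    have "word_map q (v @ u) (word_map q u s) = word_map q u s"
      by (rule on[OF _ uv(2) vu]) (simp add: u v)
    hence "word_map q u (word_map q w s) = word_map q u s" by (simp add: uv(1))
    thus ?thesis by (metis word_map_word_inv(1)[OF q u] id_apply)
  qed
qed

lemma word_map_id_iff:
  assumes "w \<in> words X"
  shows "fold A w = id \<longleftrightarrow> fold B w = id"
proof -
  have q: "(\<lambda>g. g) ` X \<subseteq> Homeo_plus" and r: "(\<lambda>g. quot g E) ` X \<subseteq> Homeo_plus"
    using Homeo_X quot_in_Homeo_plus by auto
  show ?thesis
  proof
    assume "fold A w = id"
    thus "fold B w = id"
      by (rule word_map_id_transfer[OF r q _ _ assms, rotated 2]) (rule B_eq_A_off_U word_id_on_U; assumption)+
  next
    assume "fold B w = id"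
    thus "fold A w = id"
      by (rule word_map_id_transfer[OF q r _ _ assms, rotated 2])
        (rule B_eq_A_off_U[symmetric] word_id_on_U; assumption)+
  qed
qed

end

theorem theorem9p1:
  fixes X E :: "hom set" and m :: "hom \<Rightarrow> real" and J :: "real set"
  assumes "X \<subseteq> Homeo_plus"
    and "geometrically_fast_with X m"
    and "extraneous_witnessed X m E J"
  shows "\<exists>\<phi>. \<phi> \<in> iso (gen_group X) (gen_group (quot_set X E)) \<and>
             (\<forall>g\<in>X. \<phi> g = quot g E)"
proof -
  obtain f where f: "is_interval J" "f \<in> X"
    "\<forall>a\<in>E. isolated_bump_in (used_bumps X) a \<and> used_in a f \<and> supt a \<subseteq> J"
    and b: "\<exists>b s. used_in b f \<and> b \<notin> E \<and> foot m b s \<subseteq> J"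
    and feet: "\<forall>g\<in>X - {f}. \<forall>F\<in>feet_of m g. F \<inter> J = {}"
    using assms(3) unfolding extraneous_witnessed_def by (elim conjE bexE) (rule that)
  obtain b sb where b: "used_in b f" "b \<notin> E" "foot m b sb \<subseteq> J" using b by (elim exE conjE)
  interpret extraneous_bumps X E m J f b sb
  proof
    show "foot m a s \<inter> J = {}" if "g \<in> X" "g \<noteq> f" "used_in a g" for g a s
    proof -
      have "foot m a s \<in> feet_of m g" using that by (auto simp: feet_of_def)
      thus ?thesis using feet that by blast
    qed
  qed (use assms(1,2) f b in blast)+
  have "(\<lambda>g. g) ` X \<subseteq> Homeo_plus" "(\<lambda>g. quot g E) ` X \<subseteq> Homeo_plus"
    using Homeo_X quot_in_Homeo_plus by auto
  \<comment> \<open>Here \<open>q\<close> is the identity and \<open>r\<close> the excision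
    \<open>g \<mapsto> g/E\<close>.\<close>
  from iso_by_words[OF this word_map_id_iff] show ?thesis by (simp add: quot_set_def)
qed

end
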